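(* Let $p$ be a prime and let $n\ge 1$ be an integer. Let $m$ be one of the two integers $\{(2n+1)p\}^2+2$ and $\{(2n+1)p\}^2-2$, and suppose that $m$ is square-free. Then: (I) the Diophantine equation $x^2-my^2=p$ has no solution in integers $x,y$; and (II) the only possible solutions of $x^2-my^2=-p$ in positive integers $(x,y)$ are $(2,1)$ and $(5,2)$, and these two solutions can occur only when $m=\{(2n+1)p\}^2-2$ with $p=3$. That is, if $x,y$ are positive integers with $x^2-my^2=-p$, then $(x,y)\in\{(2,1),(5,2)\}$, $m=\{(2n+1)p\}^2-2$ and $p=3$.
   Formalization: The prime p is additionally assumed to be different from 2; for p = 2 the claim fails for every n, since x = (2n+1)p, y = 1 solves one of the two equations (e.g. 6² − 34·1² = 2, 6² − 38·1² = −2). *)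

theory Defs
  imports Main "HOL-Computational_Algebra.Primes" "HOL-Computational_Algebra.Squarefree"
begin

end

theory Submission
  imports Defs
begin

text \<open>
  Put \<open>N = (2n+1)p\<close>, so that \<open>m = N\<^sup>2 + 2e\<close> with \<open>e = 1\<close> or \<open>e = -1\<close>.  The quadratic order
  \<open>\<int>[\<surd>m]\<close> contains the explicit unit \<open>(N\<^sup>2 + e) + N\<surd>m\<close> of norm 1.  Multiplying a
  solution of \<open>x\<^sup>2 - m y\<^sup>2 = k\<close> by the inverse of this unit makes \<open>\<bar>y\<bar>\<close> smaller as long as
  \<open>2 y\<^sup>2 > \<bar>k\<bar>\<close> (lemma \<open>unit_step_decreases\<close>), so for \<open>2\<bar>k\<bar> < m\<close> any solvable equation has a
  solution with \<open>2 y\<^sup>2 \<le> \<bar>k\<bar>\<close> (lemma \<open>reduced_solution\<close>).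

  For such a small solution, \<open>x\<^sup>2\<close> differs from \<open>(N y)\<^sup>2\<close> by \<open>2 e y\<^sup>2 + k\<close>, which is at most
  \<open>2\<bar>k\<bar>\<close> in absolute value.  If \<open>\<bar>k\<bar> < N\<close>, then this is less than the distance from
  \<open>(N y)\<^sup>2\<close> to the nearest other square unless \<open>y = 0\<close>; and for odd \<open>k\<close> the
  difference is odd, hence nonzero.  So \<open>y = 0\<close>, and \<open>k = x\<^sup>2\<close> is a perfect square
  (lemma \<open>odd_value_below_N_is_square\<close>).  Neither \<open>p\<close> nor \<open>-p\<close> is a square,
  and \<open>p < N\<close>, so both equations are unsolvable.  In particular (II) holds vacuously: the pairs
  \<open>(2, 1)\<close> and \<open>(5, 2)\<close> solve the second equation for \<open>p = 3\<close> and \<open>m = 7\<close>, which is the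
  excluded case \<open>n = 0\<close>.
\<close>

text \<open>
  The new pair is the product of \<open>x + y\<surd>m\<close> with \<open>(N\<^sup>2 + e) - N\<surd>m\<close>.
\<close>

lemma unit_step_preserves_norm:
  fixes N e k m x y :: int
  assumes e: "e = 1 \<or> e = -1" and m: "m = N\<^sup>2 + 2 * e" and sol: "x\<^sup>2 - m * y\<^sup>2 = k"
  shows "((N\<^sup>2 + e) * x - N * m * y)\<^sup>2 - m * ((N\<^sup>2 + e) * y - N * x)\<^sup>2 = k"
proof -
  have "(N\<^sup>2 + e)\<^sup>2 - m * N\<^sup>2 = 1"
    using e unfolding m by (auto simp: power2_eq_square algebra_simps)
  moreover have "((N\<^sup>2 + e) * x - N * m * y)\<^sup>2 - m * ((N\<^sup>2 + e) * y - N * x)\<^sup>2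
      = ((N\<^sup>2 + e)\<^sup>2 - m * N\<^sup>2) * (x\<^sup>2 - m * y\<^sup>2)"
    by (simp add: power2_eq_square algebra_simps)
  ultimately show ?thesis
    using sol by simp
qed

text \<open>
  The new second coordinate fails to be smaller only if \<open>x / y\<close> lies outside the interval
  between \<open>N\<close> and \<open>m / N\<close>, which contains \<open>\<surd>m\<close>.  At the endpoint \<open>N\<close> the
  form takes the value \<open>-2 e y\<^sup>2\<close>, and at \<open>m / N\<close> the value \<open>2 e y\<^sup>2 m / N\<^sup>2\<close>;
  so outside the interval it would have absolute value at least about \<open>2 y\<^sup>2\<close>, more than \<open>\<bar>k\<bar>\<close>.
  For \<open>e = -1\<close> the factor \<open>m / N\<^sup>2\<close> is slightly below 1, and
  \<open>2\<bar>k\<bar> < m\<close> makes up for the loss since \<open>k\<close> and \<open>2 y\<^sup>2\<close> are integers.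
\<close>

lemma unit_step_decreases:
  fixes N e k m x y :: int
  assumes e: "e = 1 \<or> e = -1" and m: "m = N\<^sup>2 + 2 * e" and N: "N > 0"
    and k: "2 * \<bar>k\<bar> < m" and sol: "x\<^sup>2 - m * y\<^sup>2 = k"
    and nonneg: "x \<ge> 0" "y \<ge> 0" and big: "\<bar>k\<bar> < 2 * y\<^sup>2"
  shows "\<bar>(N\<^sup>2 + e) * y - N * x\<bar> < y"
proof -
  have m0: "m > 0" using k by simp
  have at_N: "x\<^sup>2 - (N * y)\<^sup>2 = k + 2 * e * y\<^sup>2"
    using sol unfolding m by (simp add: power2_eq_square algebra_simps)
  have at_mN: "(N * x)\<^sup>2 - (m * y)\<^sup>2 = N\<^sup>2 * k - 2 * e * (m * y\<^sup>2)"
  proof -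
    have "(N * x)\<^sup>2 - (m * y)\<^sup>2 = N\<^sup>2 * (x\<^sup>2 - m * y\<^sup>2) + (N\<^sup>2 - m) * (m * y\<^sup>2)"
      by (simp add: power2_eq_square algebra_simps)
    then show ?thesis
      using sol by (simp add: m)
  qed
  have scaled: "N\<^sup>2 * \<bar>k\<bar> < 2 * (m * y\<^sup>2)"
  proof -
    have "N\<^sup>2 * \<bar>k\<bar> = m * \<bar>k\<bar> - 2 * e * \<bar>k\<bar>"
      unfolding m by (simp add: algebra_simps)
    also have "\<dots> \<le> m * \<bar>k\<bar> + 2 * \<bar>k\<bar>" using e by auto
    also have "\<dots> < m * (\<bar>k\<bar> + 1)" using k by (simp add: algebra_simps)
    also have "\<dots> \<le> m * (2 * y\<^sup>2)" using big m0 by (intro mult_left_mono) auto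
    finally show ?thesis by (simp add: algebra_simps)
  qed
  have k_scaled: "\<bar>N\<^sup>2 * k\<bar> = N\<^sup>2 * \<bar>k\<bar>" by (simp add: abs_mult)
  have Ny: "N * y \<ge> 0" and Nx: "N * x \<ge> 0" and my: "m * y \<ge> 0"
    using N nonneg m0 by auto
  from e show ?thesis
  proof
    assume e1: "e = 1"
    have "(N * y)\<^sup>2 < x\<^sup>2" using at_N big e1 by auto
    then have "N * y < x" using nonneg(1) by (rule power_less_imp_less_base)
    then have "N * (N * y) < N * x" using N by simp
    moreover have "(N * x)\<^sup>2 - (m * y)\<^sup>2 = N\<^sup>2 * k - 2 * (m * y\<^sup>2)"
      using at_mN e1 by simp
    then have "(N * x)\<^sup>2 < (m * y)\<^sup>2" using scaled k_scaled by linarith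
    then have "N * x < m * y" using my by (rule power_less_imp_less_base)
    ultimately show ?thesis
      using e1 unfolding m by (simp add: power2_eq_square algebra_simps abs_less_iff)
  next
    assume e1: "e = -1"
    have "x\<^sup>2 < (N * y)\<^sup>2" using at_N big e1 by auto
    then have "x < N * y" using Ny by (rule power_less_imp_less_base)
    then have "N * x < N * (N * y)" using N by simp
    moreover have "(N * x)\<^sup>2 - (m * y)\<^sup>2 = N\<^sup>2 * k + 2 * (m * y\<^sup>2)"
      using at_mN e1 by simp
    then have "(m * y)\<^sup>2 < (N * x)\<^sup>2" using scaled k_scaled by linarith
    then have "m * y < N * x" using Nx by (rule power_less_imp_less_base)
    ultimately show ?thesis
      using e1 unfolding m by (simp add: power2_eq_square algebra_simps abs_less_iff)
  qed
qed

lemma reduced_solution: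
  fixes N e k m x y :: int
  assumes e: "e = 1 \<or> e = -1" and m: "m = N\<^sup>2 + 2 * e" and N: "N > 0"
    and k: "2 * \<bar>k\<bar> < m" and sol: "x\<^sup>2 - m * y\<^sup>2 = k"
  shows "\<exists>x' y'. x'\<^sup>2 - m * y'\<^sup>2 = k \<and> 2 * y'\<^sup>2 \<le> \<bar>k\<bar>"
  using sol
proof (induction "nat \<bar>y\<bar>" arbitrary: x y rule: less_induct)
  case less
  show ?case
  proof (cases "2 * y\<^sup>2 \<le> \<bar>k\<bar>")
    case True
    then show ?thesis using less.prems by blast
  next
    case False
    let ?x = "(N\<^sup>2 + e) * \<bar>x\<bar> - N * m * \<bar>y\<bar>" and ?y = "(N\<^sup>2 + e) * \<bar>y\<bar> - N * \<bar>x\<bar>"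
    have abs_sol: "\<bar>x\<bar>\<^sup>2 - m * \<bar>y\<bar>\<^sup>2 = k" using less.prems by simp
    have "\<bar>?y\<bar> < \<bar>y\<bar>"
      using unit_step_decreases[OF e m N k abs_sol] False by simp
    then have "nat \<bar>?y\<bar> < nat \<bar>y\<bar>" by simp
    from less.hyps[OF this unit_step_preserves_norm[OF e m abs_sol]] show ?thesis .
  qed
qed

text \<open>
  The solvable values of small absolute value are the norms attached to the convergents of
  \<open>\<surd>(N\<^sup>2 + 2e)\<close>; up to square factors the only ones below \<open>N\<close> are \<open>1\<close> and \<open>-2e\<close>.
\<close>

lemma odd_value_below_N_is_square:
  fixes N e k m x y :: int
  assumes e: "e = 1 \<or> e = -1" and m: "m = N\<^sup>2 + 2 * e" and N: "N \<ge> 3"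
    and odd: "odd k" and k: "\<bar>k\<bar> < N" and sol: "x\<^sup>2 - m * y\<^sup>2 = k"
  shows "\<exists>z. k = z\<^sup>2"
proof -
  have "3 * N \<le> N\<^sup>2" using N by (simp add: power2_eq_square)
  then have "2 * \<bar>k\<bar> < m" using e k N unfolding m by auto
  then obtain a b where sol': "a\<^sup>2 - m * b\<^sup>2 = k" and small: "2 * b\<^sup>2 \<le> \<bar>k\<bar>"
    using reduced_solution[OF e m _ _ sol] N by auto
  have "b = 0"
  proof (rule ccontr)
    assume b: "b \<noteq> 0"
    define A B where "A = \<bar>a\<bar>" and "B = N * \<bar>b\<bar>"
    have B: "N \<le> B" using b N unfolding B_def by (simp add: mult_le_cancel_left1)
    have A: "A \<ge> 0" by (simp add: A_def)
    have diff: "A\<^sup>2 - B\<^sup>2 = 2 * e * b\<^sup>2 + k"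
      using sol' unfolding A_def B_def m by (simp add: power2_eq_square algebra_simps)
    have "\<bar>A\<^sup>2 - B\<^sup>2\<bar> \<le> 2 * \<bar>k\<bar>" using e small zero_le_power2[of b] unfolding diff by (elim disjE; simp; linarith)
    then have close: "\<bar>A\<^sup>2 - B\<^sup>2\<bar> < 2 * B - 1" using k B by linarith
    have "odd (A\<^sup>2 - B\<^sup>2)" using odd unfolding diff by simp
    then have "A \<noteq> B" by auto
    then consider "A \<le> B - 1" | "B + 1 \<le> A" by linarith
    then show False
    proof cases
      case 1
      then have "A\<^sup>2 \<le> (B - 1)\<^sup>2" using A by (rule power_mono)
      then show False using close by (simp add: power2_eq_square algebra_simps)
    next
      case 2
      then have "(B + 1)\<^sup>2 \<le> A\<^sup>2" using B N by (intro power_mono) auto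
      then show False using close by (simp add: power2_eq_square algebra_simps)
    qed
  qed
  then show ?thesis using sol' by auto
qed

lemma prime_not_square:
  fixes p z :: int
  assumes "prime p"
  shows "p \<noteq> z\<^sup>2"
  using assms by (auto simp: prime_power_iff)

theorem theorem2p3:
  fixes p n m :: int
  assumes "prime p"
    and "p \<noteq> 2"
    and "n \<ge> 1"
    and "m = ((2 * n + 1) * p)\<^sup>2 + 2 \<or> m = ((2 * n + 1) * p)\<^sup>2 - 2"
    and "squarefree m"
  shows "(\<nexists>x y :: int. x\<^sup>2 - m * y\<^sup>2 = p) \<and>
         (\<forall>x y :: int. x > 0 \<and> y > 0 \<and> x\<^sup>2 - m * y\<^sup>2 = - p \<longrightarrow>
            (x, y) \<in> {(2, 1), (5, 2)} \<and> m = ((2 * n + 1) * p)\<^sup>2 - 2 \<and> p = 3)"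
proof -
  define N where "N = (2 * n + 1) * p"
  obtain e where e: "e = 1 \<or> e = -1" and m: "m = N\<^sup>2 + 2 * e"
    using assms(4) unfolding N_def by (metis add_uminus_conv_diff mult.right_neutral mult_minus_right)
  have p: "p > 2" using prime_ge_2_int[OF assms(1)] assms(2) by linarith
  have "3 * p \<le> N" unfolding N_def using assms(3) p by (intro mult_right_mono) auto
  then have N: "N \<ge> 3" "p < N" using p by linarith+
  have odd_p: "odd p" using assms(1) p by (simp add: prime_odd_int)
  have unsolvable: "x\<^sup>2 - m * y\<^sup>2 \<noteq> k" if "k = p \<or> k = - p" for k x y
  proof
    assume "x\<^sup>2 - m * y\<^sup>2 = k"
    moreover have "odd k" "\<bar>k\<bar> < N" using that odd_p p N by auto
    ultimately obtain z where z: "k = z\<^sup>2"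
      using odd_value_below_N_is_square[OF e m N(1)] by blast
    then have "k \<ge> 0" by (metis zero_le_power2)
    then have "p = z\<^sup>2" using that p z by linarith
    with prime_not_square[OF assms(1)] show False by blast
  qed
  then show ?thesis by blast
qed

end
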